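(* Let $X$ be a (real, non-trivial) Banach space with the weak operator Daugavet property (WODP). Then the projective tensor product $X\widehat{\otimes}_\pi Y$ has the diametral diameter two property (DD2P) for every (real, non-trivial) Banach space $Y$.
   Context: All Banach spaces are real and non-trivial (i.e. $\neq\{0\}$). $B_Z$ and $S_Z$ denote the closed unit ball and the unit sphere of a Banach space $Z$, and $Z^*$ its topological dual. Slice of $B_Z$: a set of the form $\{z\in B_Z: z^*(z)>\sup z^*(B_Z)-\alpha\}$ with $z^*\in Z^*$ and $\alpha>0$. WODP: a Banach space $Z$ has the weak operator Daugavet property (WODP) if for all $n\in\mathbb N$, $z_1,\ldots,z_n\in S_Z$, every $\varepsilon>0$, every slice $S$ of $B_Z$ and every $z'\in B_Z$ there exist $z\in S$ and a bounded linear operator $T:Z\to Z$ with $\|T\|\leq 1+\varepsilon$, $\|T(z_i)-z_i\|<\varepsilon$ for every $i\in\{1,\ldots,n\}$, and $\|T(z)-z'\|<\varepsilon$. DD2P: a Banach space $Z$ has the diametral diameter two property (DD2P) if for every non-empty relatively weakly open subset $W$ of $B_Z$, every $z\in W\cap S_Z$ and every $\varepsilon>0$ there exists $w\in W$ with $\|w-z\|>2-\varepsilon$. Projective tensor product: $X\widehat{\otimes}_\pi Y$ is the completion of the algebraic tensor product $X\otimes Y$ under the norm $\|z\|_\pi=\inf\{\sum_{n=1}^k\|x_n\|\|y_n\|: z=\sum_{n=1}^k x_n\otimes y_n\}$, the infimum being over all such representations of $z$. *)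

theory Defs
  imports "HOL-Analysis.Analysis" "HOL-Analysis.Finite_Function_Topology"
begin

section \<open>The algebraic tensor product\<close>

text \<open>
  The type \<open>('a \<times> 'b) \<Rightarrow>\<^sub>0 real\<close> of finitely supported functions is the free real
  vector space on \<open>'a \<times> 'b\<close>, with basis \<open>Poly_Mapping.single (x, y) 1\<close>.
\<close>

definition bilinear_relations :: "(('a::real_vector \<times> 'b::real_vector) \<Rightarrow>\<^sub>0 real) set" where
  "bilinear_relations =
     {Poly_Mapping.single (x + x', y) 1 - Poly_Mapping.single (x, y) 1
        - Poly_Mapping.single (x', y) 1 | x x' y. True} \<union>
     {Poly_Mapping.single (x, y + y') 1 - Poly_Mapping.single (x, y) 1
        - Poly_Mapping.single (x, y') 1 | x y y'. True} \<union>
     {Poly_Mapping.single (r *\<^sub>R x, y) 1 - r *\<^sub>R Poly_Mapping.single (x, y) 1 | r x y. True} \<union>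
     {Poly_Mapping.single (x, r *\<^sub>R y) 1 - r *\<^sub>R Poly_Mapping.single (x, y) 1 | r x y. True}"

quotient_type (overloaded) ('a, 'b) tensor =
    "('a::real_vector \<times> 'b::real_vector) \<Rightarrow>\<^sub>0 real" /
    "\<lambda>f g. f - g \<in> span bilinear_relations"
proof (intro equivpI reflpI sympI transpI)
  fix f g h :: "('a \<times> 'b) \<Rightarrow>\<^sub>0 real"
  show "f - f \<in> span bilinear_relations" by (simp add: span_zero)
  show "g - f \<in> span bilinear_relations" if "f - g \<in> span bilinear_relations"
    using span_neg[OF that] by simp
  show "f - h \<in> span bilinear_relations"
    if "f - g \<in> span bilinear_relations" "g - h \<in> span bilinear_relations"
    using span_add[OF that] by simp
qed

instantiation tensor :: (real_vector, real_vector) real_vector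
begin

lift_definition zero_tensor :: "('a, 'b) tensor" is 0 .

lift_definition plus_tensor :: "('a, 'b) tensor \<Rightarrow> ('a, 'b) tensor \<Rightarrow> ('a, 'b) tensor" is "(+)"
  using span_add by (metis add_diff_add)

lift_definition minus_tensor :: "('a, 'b) tensor \<Rightarrow> ('a, 'b) tensor \<Rightarrow> ('a, 'b) tensor" is "(-)"
proof -
  fix f f' g g' :: "('a \<times> 'b) \<Rightarrow>\<^sub>0 real"
  assume "f - f' \<in> span bilinear_relations" "g - g' \<in> span bilinear_relations"
  then have "(f - f') - (g - g') \<in> span bilinear_relations" by (rule span_diff)
  then show "f - g - (f' - g') \<in> span bilinear_relations" by (simp add: algebra_simps)
qed

lift_definition uminus_tensor :: "('a, 'b) tensor \<Rightarrow> ('a, 'b) tensor" is uminus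
proof -
  fix f f' :: "('a \<times> 'b) \<Rightarrow>\<^sub>0 real"
  assume "f - f' \<in> span bilinear_relations"
  then have "- (f - f') \<in> span bilinear_relations" by (rule span_neg)
  then show "- f - - f' \<in> span bilinear_relations" by (simp add: algebra_simps)
qed

lift_definition scaleR_tensor :: "real \<Rightarrow> ('a, 'b) tensor \<Rightarrow> ('a, 'b) tensor" is "(*\<^sub>R)"
  by (metis scaleR_right_diff_distrib span_scale)

instance
  by standard (transfer, simp add: algebra_simps span_zero)+

end

lift_definition elem_tensor :: "'a::real_vector \<Rightarrow> 'b::real_vector \<Rightarrow> ('a, 'b) tensor"
  is "\<lambda>x y. Poly_Mapping.single (x, y) 1" .

lemma elem_tensor_add_left: "elem_tensor (x + x') y = elem_tensor x y + elem_tensor x' y"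
proof transfer
  fix x x' :: 'a and y :: 'b
  have "Poly_Mapping.single (x + x', y) (1::real) - Poly_Mapping.single (x, y) 1
      - Poly_Mapping.single (x', y) 1 \<in> bilinear_relations"
    unfolding bilinear_relations_def by blast
  from span_base[OF this]
  show "Poly_Mapping.single (x + x', y) (1::real)
      - (Poly_Mapping.single (x, y) 1 + Poly_Mapping.single (x', y) 1) \<in> span bilinear_relations"
    by (simp add: diff_diff_eq)
qed

lemma elem_tensor_add_right: "elem_tensor x (y + y') = elem_tensor x y + elem_tensor x y'"
proof transfer
  fix x :: 'a and y y' :: 'b
  have "Poly_Mapping.single (x, y + y') (1::real) - Poly_Mapping.single (x, y) 1
      - Poly_Mapping.single (x, y') 1 \<in> bilinear_relations"
    unfolding bilinear_relations_def by blast
  from span_base[OF this]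
  show "Poly_Mapping.single (x, y + y') (1::real)
      - (Poly_Mapping.single (x, y) 1 + Poly_Mapping.single (x, y') 1) \<in> span bilinear_relations"
    by (simp add: diff_diff_eq)
qed

lemma elem_tensor_scaleR_left: "elem_tensor (r *\<^sub>R x) y = r *\<^sub>R elem_tensor x y"
  by transfer (rule span_base, unfold bilinear_relations_def, blast)

lemma elem_tensor_scaleR_right: "elem_tensor x (r *\<^sub>R y) = r *\<^sub>R elem_tensor x y"
  by transfer (rule span_base, unfold bilinear_relations_def, blast)

lemma tensor_representation: "\<exists>ps. z = (\<Sum>(x, y)\<leftarrow>ps. elem_tensor x y)"
proof -
  have single: "abs_tensor (Poly_Mapping.single p r) = elem_tensor (r *\<^sub>R fst p) (snd p)"
    for p :: "'a \<times> 'b" and r :: real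
  proof -
    have "Poly_Mapping.single p r = r *\<^sub>R Poly_Mapping.single p (1::real)"
      by (rule poly_mapping_eqI)
        (simp add: scaleR_poly_mapping_def lookup_Abs_poly_mapping when_def lookup_single)
    then have "abs_tensor (Poly_Mapping.single p r) = r *\<^sub>R elem_tensor (fst p) (snd p)"
      by (simp add: elem_tensor.abs_eq scaleR_tensor.abs_eq)
    then show ?thesis by (simp add: elem_tensor_scaleR_left)
  qed
  have "\<exists>ps. abs_tensor f = (\<Sum>(x, y)\<leftarrow>ps. elem_tensor x y)" for f :: "('a \<times> 'b) \<Rightarrow>\<^sub>0 real"
  proof (induction f rule: update_induct)
    case const
    show ?case by (rule exI[of _ "[]"]) (simp add: zero_tensor_def)
  next
    case (update f p r)
    then obtain ps where ps: "abs_tensor f = (\<Sum>(x, y)\<leftarrow>ps. elem_tensor x y)" by blast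
    have "Poly_Mapping.update p r f = Poly_Mapping.single p r + f"
    proof (rule poly_mapping_eqI)
      fix q
      show "Poly_Mapping.lookup (Poly_Mapping.update p r f) q = Poly_Mapping.lookup (Poly_Mapping.single p r + f) q"
        using update(1)
        by (cases "q = p") (simp_all add: Poly_Mapping.update.rep_eq lookup_add lookup_single
            in_keys_iff when_def)
    qed
    then have "abs_tensor (Poly_Mapping.update p r f) = elem_tensor (r *\<^sub>R fst p) (snd p) + abs_tensor f"
      by (simp add: single flip: plus_tensor.abs_eq)
    with ps show ?case by (intro exI[of _ "(r *\<^sub>R fst p, snd p) # ps"]) simp
  qed
  then show ?thesis by (induction z rule: tensor.abs_induct) auto
qed

section \<open>The projective norm\<close>

definition proj_norm :: "('a::real_normed_vector, 'b::real_normed_vector) tensor \<Rightarrow> real" where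
  "proj_norm z =
     Inf {\<Sum>(x, y)\<leftarrow>ps. norm x * norm y | ps. z = (\<Sum>(x, y)\<leftarrow>ps. elem_tensor x y)}"

lemma proj_norm_sum_nonneg:
  "0 \<le> (\<Sum>(x, y)\<leftarrow>ps. norm (x :: 'a::real_normed_vector) * norm (y :: 'b::real_normed_vector))"
  by (rule sum_list_nonneg) auto

lemma proj_norm_le:
  assumes "z = (\<Sum>(x, y)\<leftarrow>ps. elem_tensor x y)"
  shows "proj_norm z \<le> (\<Sum>(x, y)\<leftarrow>ps. norm x * norm y)"
  unfolding proj_norm_def
  by (rule cInf_lower) (use assms proj_norm_sum_nonneg in \<open>auto intro!: bdd_belowI[of _ 0]\<close>)

lemma proj_norm_approx:
  assumes "e > 0"
  shows "\<exists>ps. z = (\<Sum>(x, y)\<leftarrow>ps. elem_tensor x y) \<and>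
    (\<Sum>(x, y)\<leftarrow>ps. norm x * norm y) < proj_norm z + e"
proof -
  let ?S = "{\<Sum>(x, y)\<leftarrow>ps. norm x * norm y | ps. z = (\<Sum>(x, y)\<leftarrow>ps. elem_tensor x y)}"
  have "?S \<noteq> {}" using tensor_representation[of z] by auto
  moreover have "Inf ?S < proj_norm z + e" using assms by (simp add: proj_norm_def)
  ultimately show ?thesis using cInf_lessD[of ?S] by auto
qed

lemma proj_norm_nonneg: "0 \<le> proj_norm z"
  unfolding proj_norm_def
  by (rule cInf_greatest) (use tensor_representation[of z] proj_norm_sum_nonneg in auto)

lemma proj_norm_triangle: "proj_norm (z + w) \<le> proj_norm z + proj_norm w"
proof (rule field_le_epsilon)
  fix e :: real assume "e > 0"
  then have e: "e / 2 > 0" by simp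
  obtain ps where ps: "z = (\<Sum>(x, y)\<leftarrow>ps. elem_tensor x y)"
    "(\<Sum>(x, y)\<leftarrow>ps. norm x * norm y) < proj_norm z + e / 2"
    using proj_norm_approx[OF e] by blast
  obtain qs where qs: "w = (\<Sum>(x, y)\<leftarrow>qs. elem_tensor x y)"
    "(\<Sum>(x, y)\<leftarrow>qs. norm x * norm y) < proj_norm w + e / 2"
    using proj_norm_approx[OF e] by blast
  have "z + w = (\<Sum>(x, y)\<leftarrow>ps @ qs. elem_tensor x y)" using ps qs by simp
  from proj_norm_le[OF this] show "proj_norm (z + w) \<le> proj_norm z + proj_norm w + e"
    using ps qs by simp
qed

lemma proj_norm_zero [simp]: "proj_norm 0 = 0"
  by (rule antisym[OF _ proj_norm_nonneg]) (use proj_norm_le[of 0 "[]"] in simp)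

lemma proj_norm_scaleR_le: "proj_norm (r *\<^sub>R z) \<le> \<bar>r\<bar> * proj_norm z"
proof (cases "r = 0")
  case False
  show ?thesis
  proof (rule field_le_epsilon)
    fix e :: real assume "e > 0"
    with False have e: "e / \<bar>r\<bar> > 0" by simp
    obtain ps where ps: "z = (\<Sum>(x, y)\<leftarrow>ps. elem_tensor x y)"
      "(\<Sum>(x, y)\<leftarrow>ps. norm x * norm y) < proj_norm z + e / \<bar>r\<bar>"
      using proj_norm_approx[OF e] by blast
    let ?qs = "map (\<lambda>(x, y). (r *\<^sub>R x, y)) ps"
    have "r *\<^sub>R (\<Sum>(x, y)\<leftarrow>ps. elem_tensor x y) = (\<Sum>(x, y)\<leftarrow>?qs. elem_tensor x y)"
      by (induction ps) (auto simp: elem_tensor_scaleR_left scaleR_add_right)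
    then have "r *\<^sub>R z = (\<Sum>(x, y)\<leftarrow>?qs. elem_tensor x y)" using ps(1) by simp
    then have "proj_norm (r *\<^sub>R z) \<le> (\<Sum>(x, y)\<leftarrow>?qs. norm x * norm y)" by (rule proj_norm_le)
    also have "\<dots> = \<bar>r\<bar> * (\<Sum>(x, y)\<leftarrow>ps. norm x * norm y)"
      by (induction ps) (auto simp: algebra_simps)
    also have "\<dots> \<le> \<bar>r\<bar> * (proj_norm z + e / \<bar>r\<bar>)"
      using ps(2) by (intro mult_left_mono) auto
    also have "\<dots> = \<bar>r\<bar> * proj_norm z + e" using False by (simp add: field_simps)
    finally show "proj_norm (r *\<^sub>R z) \<le> \<bar>r\<bar> * proj_norm z + e" .
  qed
qed simp

lemma proj_norm_scaleR: "proj_norm (r *\<^sub>R z) = \<bar>r\<bar> * proj_norm z"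
proof (cases "r = 0")
  case False
  have "proj_norm z = proj_norm (inverse r *\<^sub>R (r *\<^sub>R z))" using False by simp
  also have "\<dots> \<le> \<bar>inverse r\<bar> * proj_norm (r *\<^sub>R z)" by (rule proj_norm_scaleR_le)
  finally have "\<bar>r\<bar> * proj_norm z \<le> proj_norm (r *\<^sub>R z)"
    using False by (simp add: field_simps)
  with proj_norm_scaleR_le[of r z] show ?thesis by simp
qed simp

lemma proj_norm_uminus [simp]: "proj_norm (- z) = proj_norm z"
  using proj_norm_scaleR[of "-1" z] by simp

lemma proj_norm_minus_commute: "proj_norm (z - w) = proj_norm (w - z)"
  using proj_norm_uminus[of "z - w"] by simp

lemma proj_norm_diff_triangle: "proj_norm (z - w) \<le> proj_norm (z - v) + proj_norm (v - w)"
  using proj_norm_triangle[of "z - v" "v - w"] by simp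

lemma proj_norm_reverse: "\<bar>proj_norm z - proj_norm w\<bar> \<le> proj_norm (z - w)"
  using proj_norm_triangle[of "z - w" w] proj_norm_triangle[of "w - z" z]
    proj_norm_minus_commute[of z w] by simp

section \<open>The projective tensor product\<close>

definition proj_Cauchy ::
    "(nat \<Rightarrow> ('a::real_normed_vector, 'b::real_normed_vector) tensor) \<Rightarrow> bool" where
  "proj_Cauchy u \<longleftrightarrow> (\<forall>e>0. \<exists>M. \<forall>m\<ge>M. \<forall>n\<ge>M. proj_norm (u m - u n) < e)"

lemma proj_Cauchy_const [simp]: "proj_Cauchy (\<lambda>n. z)"
  by (simp add: proj_Cauchy_def)

lemma proj_Cauchy_add:
  assumes "proj_Cauchy u" "proj_Cauchy v"
  shows "proj_Cauchy (\<lambda>n. u n + v n)"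
  unfolding proj_Cauchy_def
proof (intro allI impI)
  fix e :: real assume "e > 0"
  then have "e / 2 > 0" by simp
  then obtain M N where M: "\<forall>m\<ge>M. \<forall>n\<ge>M. proj_norm (u m - u n) < e / 2"
    and N: "\<forall>m\<ge>N. \<forall>n\<ge>N. proj_norm (v m - v n) < e / 2"
    using assms unfolding proj_Cauchy_def by blast
  have "proj_norm (u m + v m - (u n + v n)) < e" if "m \<ge> max M N" "n \<ge> max M N" for m n
  proof -
    have "proj_norm (u m + v m - (u n + v n)) \<le> proj_norm (u m - u n) + proj_norm (v m - v n)"
      using proj_norm_triangle[of "u m - u n" "v m - v n"] by (simp add: algebra_simps)
    also have "\<dots> < e / 2 + e / 2" using that M N by (intro add_strict_mono) auto
    finally show ?thesis by simp
  qed
  then show "\<exists>M. \<forall>m\<ge>M. \<forall>n\<ge>M. proj_norm (u m + v m - (u n + v n)) < e" by blast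
qed

lemma proj_Cauchy_scaleR:
  assumes "proj_Cauchy u"
  shows "proj_Cauchy (\<lambda>n. r *\<^sub>R u n)"
proof (cases "r = 0")
  case False
  show ?thesis
    unfolding proj_Cauchy_def
  proof (intro allI impI)
    fix e :: real assume "e > 0"
    with False have "e / \<bar>r\<bar> > 0" by simp
    then obtain M where "\<forall>m\<ge>M. \<forall>n\<ge>M. proj_norm (u m - u n) < e / \<bar>r\<bar>"
      using assms unfolding proj_Cauchy_def by blast
    then have "\<forall>m\<ge>M. \<forall>n\<ge>M. proj_norm (r *\<^sub>R u m - r *\<^sub>R u n) < e"
      using False by (simp add: proj_norm_scaleR pos_less_divide_eq mult.commute
          flip: scaleR_right_diff_distrib)
    then show "\<exists>M. \<forall>m\<ge>M. \<forall>n\<ge>M. proj_norm (r *\<^sub>R u m - r *\<^sub>R u n) < e" by blast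
  qed
qed simp

lemma proj_Cauchy_uminus:
  assumes "proj_Cauchy u"
  shows "proj_Cauchy (\<lambda>n. - u n)"
  using proj_Cauchy_scaleR[OF assms, of "-1"] by simp

lemma proj_Cauchy_diff:
  assumes "proj_Cauchy u" "proj_Cauchy v"
  shows "proj_Cauchy (\<lambda>n. u n - v n)"
  using proj_Cauchy_add[OF assms(1) proj_Cauchy_uminus[OF assms(2)]] by simp

lemma proj_Cauchy_norm_convergent:
  assumes "proj_Cauchy u"
  shows "convergent (\<lambda>n. proj_norm (u n))"
proof (rule Cauchy_convergent, unfold Cauchy_iff, intro allI impI)
  fix e :: real assume "e > 0"
  then obtain M where "\<forall>m\<ge>M. \<forall>n\<ge>M. proj_norm (u m - u n) < e"
    using assms unfolding proj_Cauchy_def by blast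
  then have "\<forall>m\<ge>M. \<forall>n\<ge>M. norm (proj_norm (u m) - proj_norm (u n)) < e"
    using proj_norm_reverse by (metis order_le_less_trans real_norm_def)
  then show "\<exists>M. \<forall>m\<ge>M. \<forall>n\<ge>M. norm (proj_norm (u m) - proj_norm (u n)) < e" by blast
qed

lemma proj_Cauchy_lim:
  assumes "proj_Cauchy u"
  shows "(\<lambda>n. proj_norm (u n)) \<longlonglongrightarrow> lim (\<lambda>n. proj_norm (u n))"
  using proj_Cauchy_norm_convergent[OF assms] by (simp add: convergent_LIMSEQ_iff)

lemma proj_null_add:
  assumes "(\<lambda>n. proj_norm (u n)) \<longlonglongrightarrow> 0" "(\<lambda>n. proj_norm (v n)) \<longlonglongrightarrow> 0"
  shows "(\<lambda>n. proj_norm (u n + v n)) \<longlonglongrightarrow> 0"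
proof (rule Lim_null_comparison)
  show "\<forall>\<^sub>F n in sequentially. norm (proj_norm (u n + v n)) \<le> proj_norm (u n) + proj_norm (v n)"
    by (simp add: proj_norm_nonneg proj_norm_triangle)
  show "(\<lambda>n. proj_norm (u n) + proj_norm (v n)) \<longlonglongrightarrow> 0"
    using tendsto_add[OF assms] by simp
qed

text \<open>
  The completion of the algebraic tensor product: Cauchy sequences modulo null sequences. Since null
  sequences are divided out, the construction needs \<^const>\<open>proj_norm\<close> only to be a seminorm.
\<close>

quotient_type (overloaded) ('a, 'b) proj_tensor =
    "nat \<Rightarrow> ('a::real_normed_vector, 'b::real_normed_vector) tensor" / partial:
    "\<lambda>u v. proj_Cauchy u \<and> proj_Cauchy v \<and> (\<lambda>n. proj_norm (u n - v n)) \<longlonglongrightarrow> 0"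
proof (rule part_equivpI)
  show "\<exists>u :: nat \<Rightarrow> ('a, 'b) tensor. proj_Cauchy u \<and> proj_Cauchy u \<and>
      (\<lambda>n. proj_norm (u n - u n)) \<longlonglongrightarrow> 0"
    by (rule exI[of _ "\<lambda>_. 0"]) simp
  show "symp (\<lambda>u v :: nat \<Rightarrow> ('a, 'b) tensor. proj_Cauchy u \<and> proj_Cauchy v \<and>
      (\<lambda>n. proj_norm (u n - v n)) \<longlonglongrightarrow> 0)"
    by (rule sympI) (simp add: proj_norm_minus_commute)
  show "transp (\<lambda>u v :: nat \<Rightarrow> ('a, 'b) tensor. proj_Cauchy u \<and> proj_Cauchy v \<and>
      (\<lambda>n. proj_norm (u n - v n)) \<longlonglongrightarrow> 0)"
  proof (rule transpI, intro conjI; (elim conjE)?)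
    fix u v w :: "nat \<Rightarrow> ('a, 'b) tensor"
    assume "(\<lambda>n. proj_norm (u n - v n)) \<longlonglongrightarrow> 0" "(\<lambda>n. proj_norm (v n - w n)) \<longlonglongrightarrow> 0"
    from proj_null_add[OF this] show "(\<lambda>n. proj_norm (u n - w n)) \<longlonglongrightarrow> 0" by simp
  qed auto
qed

instantiation proj_tensor :: (real_normed_vector, real_normed_vector) real_vector
begin

lift_definition zero_proj_tensor :: "('a, 'b) proj_tensor" is "\<lambda>n. 0" by simp

lift_definition plus_proj_tensor ::
  "('a, 'b) proj_tensor \<Rightarrow> ('a, 'b) proj_tensor \<Rightarrow> ('a, 'b) proj_tensor" is "\<lambda>u v n. u n + v n"
  using proj_null_add by (fastforce simp: proj_Cauchy_add add_diff_add)

lift_definition uminus_proj_tensor :: "('a, 'b) proj_tensor \<Rightarrow> ('a, 'b) proj_tensor"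
  is "\<lambda>u n. - u n"
proof (elim conjE, intro conjI)
  fix u v :: "nat \<Rightarrow> ('a, 'b) tensor"
  assume "(\<lambda>n. proj_norm (u n - v n)) \<longlonglongrightarrow> 0"
  then have "(\<lambda>n. proj_norm (v n - u n)) \<longlonglongrightarrow> 0" by (subst proj_norm_minus_commute)
  then show "(\<lambda>n. proj_norm (- u n - - v n)) \<longlonglongrightarrow> 0" by simp
qed (simp_all add: proj_Cauchy_uminus)

lift_definition minus_proj_tensor ::
  "('a, 'b) proj_tensor \<Rightarrow> ('a, 'b) proj_tensor \<Rightarrow> ('a, 'b) proj_tensor" is "\<lambda>u v n. u n - v n"
proof (elim conjE, intro conjI)
  fix u u' v v' :: "nat \<Rightarrow> ('a, 'b) tensor"
  assume *: "(\<lambda>n. proj_norm (u n - u' n)) \<longlonglongrightarrow> 0" and "(\<lambda>n. proj_norm (v n - v' n)) \<longlonglongrightarrow> 0"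
  then have "(\<lambda>n. proj_norm (v' n - v n)) \<longlonglongrightarrow> 0" by (simp add: proj_norm_minus_commute)
  from proj_null_add[OF * this] show "(\<lambda>n. proj_norm (u n - v n - (u' n - v' n))) \<longlonglongrightarrow> 0"
    by (simp add: algebra_simps)
qed (simp_all add: proj_Cauchy_diff)

lift_definition scaleR_proj_tensor :: "real \<Rightarrow> ('a, 'b) proj_tensor \<Rightarrow> ('a, 'b) proj_tensor"
  is "\<lambda>r u n. r *\<^sub>R u n"
  by (auto simp: proj_Cauchy_scaleR proj_norm_scaleR intro: tendsto_mult_right_zero
      simp flip: scaleR_right_diff_distrib)

instance
  by standard (transfer; simp add: algebra_simps proj_Cauchy_add proj_Cauchy_scaleR
      proj_Cauchy_diff proj_Cauchy_uminus)+

end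

instantiation proj_tensor :: (real_normed_vector, real_normed_vector) real_normed_vector
begin

lift_definition norm_proj_tensor :: "('a, 'b) proj_tensor \<Rightarrow> real"
  is "\<lambda>u. lim (\<lambda>n. proj_norm (u n))"
proof (elim conjE)
  fix u v :: "nat \<Rightarrow> ('a, 'b) tensor"
  assume u: "proj_Cauchy u" and uv: "(\<lambda>n. proj_norm (u n - v n)) \<longlonglongrightarrow> 0"
  obtain L where L: "(\<lambda>n. proj_norm (u n)) \<longlonglongrightarrow> L"
    using proj_Cauchy_norm_convergent[OF u] by (auto simp: convergent_def)
  have "(\<lambda>n. proj_norm (v n) - proj_norm (u n)) \<longlonglongrightarrow> 0"
  proof (rule Lim_null_comparison[OF _ uv], intro always_eventually allI)
    show "norm (proj_norm (v n) - proj_norm (u n)) \<le> proj_norm (u n - v n)" for n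
      using proj_norm_reverse[of "v n" "u n"] proj_norm_minus_commute[of "v n" "u n"] by simp
  qed
  from tendsto_add[OF this L] have "(\<lambda>n. proj_norm (v n)) \<longlonglongrightarrow> L" by simp
  from limI[OF this] limI[OF L]
  show "lim (\<lambda>n. proj_norm (u n)) = lim (\<lambda>n. proj_norm (v n))" by simp
qed

definition dist_proj_tensor :: "('a, 'b) proj_tensor \<Rightarrow> ('a, 'b) proj_tensor \<Rightarrow> real" where
  "dist_proj_tensor z w = norm (z - w)"

definition sgn_proj_tensor :: "('a, 'b) proj_tensor \<Rightarrow> ('a, 'b) proj_tensor" where
  "sgn_proj_tensor z = z /\<^sub>R norm z"

definition uniformity_proj_tensor :: "(('a, 'b) proj_tensor \<times> ('a, 'b) proj_tensor) filter" where
  "uniformity_proj_tensor = (INF e\<in>{0<..}. principal {(z, w). dist z w < e})"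

definition open_proj_tensor :: "('a, 'b) proj_tensor set \<Rightarrow> bool" where
  "open_proj_tensor U \<longleftrightarrow> (\<forall>z\<in>U. \<forall>\<^sub>F (z', w) in uniformity. z' = z \<longrightarrow> w \<in> U)"

instance
proof
  fix z w :: "('a, 'b) proj_tensor" and r :: real
  show "dist z w = norm (z - w)" by (rule dist_proj_tensor_def)
  show "sgn z = z /\<^sub>R norm z" by (rule sgn_proj_tensor_def)
  show "uniformity = (INF e\<in>{0<..}. principal {(z, w :: ('a, 'b) proj_tensor). dist z w < e})"
    by (rule uniformity_proj_tensor_def)
  show "open U \<longleftrightarrow> (\<forall>z\<in>U. \<forall>\<^sub>F (z', w) in uniformity. z' = z \<longrightarrow> w \<in> U)"
    for U :: "('a, 'b) proj_tensor set"
    by (rule open_proj_tensor_def)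
  show "norm z = 0 \<longleftrightarrow> z = 0"
  proof transfer
    fix u :: "nat \<Rightarrow> ('a, 'b) tensor"
    assume "proj_Cauchy u \<and> proj_Cauchy u \<and> (\<lambda>n. proj_norm (u n - u n)) \<longlonglongrightarrow> 0"
    then show "lim (\<lambda>n. proj_norm (u n)) = 0 \<longleftrightarrow>
        proj_Cauchy u \<and> proj_Cauchy (\<lambda>n. 0 :: ('a, 'b) tensor) \<and>
        (\<lambda>n. proj_norm (u n - 0)) \<longlonglongrightarrow> 0"
      using proj_Cauchy_lim[of u] limI[of "\<lambda>n. proj_norm (u n)" 0] by auto
  qed
  show "norm (z + w) \<le> norm z + norm w"
  proof transfer
    fix u v :: "nat \<Rightarrow> ('a, 'b) tensor"
    assume "proj_Cauchy u \<and> proj_Cauchy u \<and> (\<lambda>n. proj_norm (u n - u n)) \<longlonglongrightarrow> 0"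
      "proj_Cauchy v \<and> proj_Cauchy v \<and> (\<lambda>n. proj_norm (v n - v n)) \<longlonglongrightarrow> 0"
    then have "(\<lambda>n. proj_norm (u n)) \<longlonglongrightarrow> lim (\<lambda>n. proj_norm (u n))"
      "(\<lambda>n. proj_norm (v n)) \<longlonglongrightarrow> lim (\<lambda>n. proj_norm (v n))"
      "(\<lambda>n. proj_norm (u n + v n)) \<longlonglongrightarrow> lim (\<lambda>n. proj_norm (u n + v n))"
      by (auto intro: proj_Cauchy_lim proj_Cauchy_add)
    then show "lim (\<lambda>n. proj_norm (u n + v n)) \<le>
        lim (\<lambda>n. proj_norm (u n)) + lim (\<lambda>n. proj_norm (v n))"
      by (elim LIMSEQ_le[OF _ tendsto_add]) (auto intro: proj_norm_triangle)
  qed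
  show "norm (r *\<^sub>R z) = \<bar>r\<bar> * norm z"
  proof transfer
    fix r :: real and u :: "nat \<Rightarrow> ('a, 'b) tensor"
    assume "proj_Cauchy u \<and> proj_Cauchy u \<and> (\<lambda>n. proj_norm (u n - u n)) \<longlonglongrightarrow> 0"
    then have "(\<lambda>n. proj_norm (u n)) \<longlonglongrightarrow> lim (\<lambda>n. proj_norm (u n))"
      by (simp add: proj_Cauchy_lim)
    then have "(\<lambda>n. proj_norm (r *\<^sub>R u n)) \<longlonglongrightarrow> \<bar>r\<bar> * lim (\<lambda>n. proj_norm (u n))"
      unfolding proj_norm_scaleR by (rule tendsto_mult_left)
    then show "lim (\<lambda>n. proj_norm (r *\<^sub>R u n)) = \<bar>r\<bar> * lim (\<lambda>n. proj_norm (u n))"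
      by (rule limI)
  qed
qed

end

lift_definition of_tensor ::
  "('a::real_normed_vector, 'b::real_normed_vector) tensor \<Rightarrow> ('a, 'b) proj_tensor"
  is "\<lambda>(z :: ('a, 'b) tensor) (n :: nat). z" by simp

lemma linear_of_tensor: "linear of_tensor"
  by (rule linearI; transfer; simp)

lemma norm_of_tensor: "norm (of_tensor z) = proj_norm z"
  by transfer (rule limI, rule tendsto_const)

lemma of_tensor_LIMSEQ:
  assumes u: "proj_Cauchy u"
  shows "(\<lambda>n. of_tensor (u n)) \<longlonglongrightarrow> abs_proj_tensor u"
  unfolding LIMSEQ_iff
proof (intro allI impI)
  fix e :: real assume "e > 0"
  then have "e / 2 > 0" by simp
  then obtain M where M: "\<forall>m\<ge>M. \<forall>n\<ge>M. proj_norm (u m - u n) < e / 2"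
    using u unfolding proj_Cauchy_def by blast
  have "norm (of_tensor (u m) - abs_proj_tensor u) < e" if "m \<ge> M" for m
  proof -
    have eq: "norm (of_tensor (u m) - abs_proj_tensor u) = lim (\<lambda>n. proj_norm (u m - u n))"
      using u by (simp add: of_tensor.abs_eq minus_proj_tensor.abs_eq norm_proj_tensor.abs_eq
          proj_Cauchy_diff)
    have "(\<lambda>n. proj_norm (u m - u n)) \<longlonglongrightarrow> lim (\<lambda>n. proj_norm (u m - u n))"
      using u by (intro proj_Cauchy_lim proj_Cauchy_diff) simp_all
    then have "lim (\<lambda>n. proj_norm (u m - u n)) \<le> e / 2"
      by (rule LIMSEQ_le_const2) (use M that in \<open>auto intro: less_imp_le\<close>)
    with eq \<open>e > 0\<close> show ?thesis by simp
  qed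
  then show "\<exists>M. \<forall>m\<ge>M. norm (of_tensor (u m) - abs_proj_tensor u) < e" by blast
qed

lemma of_tensor_dense: "closure (range of_tensor) = UNIV"
proof -
  have "z \<in> closure (range of_tensor)"
    for z :: "('a::real_normed_vector, 'b::real_normed_vector) proj_tensor"
  proof (induction z rule: proj_tensor.abs_induct)
    case (1 u)
    then show ?case
      unfolding closure_sequential
      by (intro exI[of _ "\<lambda>n. of_tensor (u n)"]) (simp add: of_tensor_LIMSEQ)
  qed
  then show ?thesis by auto
qed

instance proj_tensor :: (real_normed_vector, real_normed_vector) banach
proof
  fix X :: "nat \<Rightarrow> ('a, 'b) proj_tensor"
  assume X: "Cauchy X"
  have "\<exists>z. norm (X n - of_tensor z) < inverse (real (Suc n))" for n
  proof -
    have "X n \<in> closure (range of_tensor)" by (simp add: of_tensor_dense)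
    then obtain w where "w \<in> range of_tensor" "dist w (X n) < inverse (real (Suc n))"
      unfolding closure_approachable
      by (metis inverse_positive_iff_positive of_nat_0_less_iff zero_less_Suc)
    then show ?thesis by (auto simp: dist_norm norm_minus_commute)
  qed
  then obtain u where u: "\<And>n. norm (X n - of_tensor (u n)) < inverse (real (Suc n))" by metis
  have diff: "(\<lambda>n. X n - of_tensor (u n)) \<longlonglongrightarrow> 0"
    by (rule Lim_null_comparison[OF _ LIMSEQ_inverse_real_of_nat])
      (use u in \<open>auto intro!: always_eventually less_imp_le\<close>)
  have "Cauchy (\<lambda>n. of_tensor (u n))"
  proof (rule metric_CauchyI)
    fix e :: real assume "e > 0"
    then have e: "e / 3 > 0" by simp
    obtain M where M: "\<forall>m\<ge>M. \<forall>n\<ge>M. dist (X m) (X n) < e / 3"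
      using metric_CauchyD[OF X e] by blast
    obtain N where N: "\<forall>n\<ge>N. dist (X n) (of_tensor (u n)) < e / 3"
      using LIMSEQ_D[OF diff e] by (auto simp: dist_norm)
    have "dist (of_tensor (u m)) (of_tensor (u n)) < e" if "m \<ge> max M N" "n \<ge> max M N" for m n
    proof -
      have "dist (of_tensor (u m)) (X n) \<le> dist (X m) (of_tensor (u m)) + dist (X m) (X n)"
        by (rule dist_triangle3)
      moreover have "dist (of_tensor (u m)) (of_tensor (u n))
          \<le> dist (of_tensor (u m)) (X n) + dist (X n) (of_tensor (u n))"
        by (rule dist_triangle)
      moreover have "dist (X m) (X n) < e / 3" using M that by simp
      moreover have "dist (X m) (of_tensor (u m)) < e / 3" "dist (X n) (of_tensor (u n)) < e / 3"
        using N that by simp_all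
      ultimately show ?thesis by linarith
    qed
    then show "\<exists>M. \<forall>m\<ge>M. \<forall>n\<ge>M. dist (of_tensor (u m)) (of_tensor (u n)) < e" by blast
  qed
  then have "proj_Cauchy u"
    unfolding proj_Cauchy_def Cauchy_iff
    by (simp add: norm_of_tensor flip: linear_diff[OF linear_of_tensor])
  from tendsto_add[OF diff of_tensor_LIMSEQ[OF this]] show "convergent X"
    by (auto simp: convergent_def)
qed

section \<open>Slices, the weak topology, WODP and DD2P\<close>

definition slice :: "('a::real_normed_vector \<Rightarrow>\<^sub>L real) \<Rightarrow> real \<Rightarrow> 'a set" where
  "slice f \<alpha> = {z \<in> cball 0 1. blinfun_apply f z > (SUP x\<in>cball 0 1. blinfun_apply f x) - \<alpha>}"

definition weak_topology :: "'a::real_normed_vector topology" where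
  "weak_topology =
     topology_generated_by {blinfun_apply f -` U | (f :: 'a \<Rightarrow>\<^sub>L real) U. open U}"

definition WODP :: "'a::banach itself \<Rightarrow> bool" where
  "WODP _ \<longleftrightarrow>
     (\<forall>n\<ge>1. \<forall>(zs :: nat \<Rightarrow> 'a) \<epsilon> f \<alpha> z'.
        (\<forall>i\<in>{1..n}. zs i \<in> sphere 0 1) \<and> \<epsilon> > 0 \<and> \<alpha> > 0 \<and> z' \<in> cball 0 1 \<longrightarrow>
        (\<exists>z\<in>slice f \<alpha>. \<exists>T :: 'a \<Rightarrow>\<^sub>L 'a.
           norm T \<le> 1 + \<epsilon> \<and>
           (\<forall>i\<in>{1..n}. norm (blinfun_apply T (zs i) - zs i) < \<epsilon>) \<and>
           norm (blinfun_apply T z - z') < \<epsilon>))"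

definition DD2P :: "'a::banach itself \<Rightarrow> bool" where
  "DD2P _ \<longleftrightarrow>
     (\<forall>(W :: 'a set) z \<epsilon>.
        openin (subtopology weak_topology (cball 0 1)) W \<and> W \<noteq> {} \<and>
        z \<in> W \<inter> sphere 0 1 \<and> \<epsilon> > 0 \<longrightarrow>
        (\<exists>w\<in>W. norm (w - z) > 2 - \<epsilon>))"

end

theory Submission
  imports Defs
begin

text \<open>
  Let \<open>z\<close> be a unit vector of the projective tensor product and \<open>W\<close> a relatively weakly open
  subset of the unit ball that contains it. Approximate \<open>z\<close> in norm by a finite sum \<open>t = \<Sum> x \<otimes> y\<close>
  with \<open>\<Sum> \<parallel>x\<parallel> \<parallel>y\<parallel> \<le> 1\<close>. The aim is to replace every \<open>x\<close> by some \<open>u\<close> with \<open>\<parallel>u\<parallel> \<le> \<parallel>x\<parallel>\<close> such that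
  \<open>v = \<Sum> u \<otimes> y\<close> is weakly close to \<open>t\<close>, while one operator \<open>T\<close> of norm close to \<open>1\<close> almost fixes
  all the \<open>x\<close> and sends each \<open>u\<close> almost to \<open>- x\<close>. Then \<open>T \<otimes> Id\<close> maps \<open>v - t\<close> almost to \<open>- 2 t\<close>;
  as \<open>\<parallel>T \<otimes> Id\<parallel> \<le> \<parallel>T\<parallel>\<close>, the distance of \<open>v\<close> and \<open>t\<close> is almost \<open>2\<close> (\<open>reflection_far\<close>).
  As \<open>T\<close> acts on the first factor only, the WODP of that factor suffices.

  The WODP places a single vector in a \<^emph>\<open>slice\<close>, whereas weak closeness to \<open>t\<close> restricts finitely
  many functionals at once. The passage between the two is a steering argument
  (\<open>WODP_reflection\<close>). The \<open>u\<close> are chosen one after the other. If \<open>s\<close> is the vector of errors that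
  the test functionals have accumulated so far, then the next \<open>u\<close> is taken in the slice that
  makes twice the inner product of \<open>s\<close> with the new error at most \<open>\<alpha>\<close>, so that the square of the
  accumulated error grows by at most \<open>\<alpha>\<close> plus a multiple of \<open>(\<parallel>x\<parallel> \<parallel>y\<parallel>)\<^sup>2\<close>. Splitting each
  summand of \<open>t\<close> into \<open>N\<close> equal parts beforehand (\<open>tensor_representation_refine\<close>) divides the sum
  of these squares by \<open>N\<close>, so that the final error is as small as desired. The operators combine by
  composition: each new operator almost fixes the vectors treated before it, is applied first, and
  hands its own \<open>u\<close> over to the earlier operators as \<open>- x\<close>, which these almost fix.
\<close>

section \<open>Linear maps out of the tensor product\<close>

text \<open>
  The linear extension of \<open>h\<close> from the basis of the free vector space. When \<open>h\<close> is bilinear, it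
  vanishes on the relations and hence descends to the tensor product.
\<close>

definition free_extension :: "('c \<Rightarrow> 'd::real_vector) \<Rightarrow> ('c \<Rightarrow>\<^sub>0 real) \<Rightarrow> 'd" where
  "free_extension h f = (\<Sum>p\<in>Poly_Mapping.keys f. Poly_Mapping.lookup f p *\<^sub>R h p)"

lemma free_extension_superset:
  assumes "finite A" "Poly_Mapping.keys f \<subseteq> A"
  shows "free_extension h f = (\<Sum>p\<in>A. Poly_Mapping.lookup f p *\<^sub>R h p)"
  unfolding free_extension_def
  by (rule sum.mono_neutral_left) (use assms in \<open>auto simp: in_keys_iff\<close>)

lemma lookup_scaleR: "Poly_Mapping.lookup (r *\<^sub>R f) p = r * Poly_Mapping.lookup f p"
  for f :: "'c \<Rightarrow>\<^sub>0 real"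
proof -
  have "finite {q. r * Poly_Mapping.lookup f q \<noteq> 0}"
    by (rule finite_subset[OF _ finite_keys[of f]]) (auto simp: in_keys_iff)
  then show ?thesis by (simp add: scaleR_poly_mapping_def)
qed

lemma linear_free_extension: "linear (free_extension h)"
proof (rule linearI)
  fix f g :: "'a \<Rightarrow>\<^sub>0 real" and r :: real
  let ?A = "Poly_Mapping.keys f \<union> Poly_Mapping.keys g"
  have "free_extension h (f + g) = (\<Sum>p\<in>?A. Poly_Mapping.lookup (f + g) p *\<^sub>R h p)"
    by (rule free_extension_superset) (simp_all add: keys_add)
  moreover have "free_extension h f = (\<Sum>p\<in>?A. Poly_Mapping.lookup f p *\<^sub>R h p)"
    "free_extension h g = (\<Sum>p\<in>?A. Poly_Mapping.lookup g p *\<^sub>R h p)"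
    by (rule free_extension_superset; simp)+
  ultimately show "free_extension h (f + g) = free_extension h f + free_extension h g"
    by (simp add: lookup_add scaleR_add_left sum.distrib)
  have "free_extension h (r *\<^sub>R f)
      = (\<Sum>p\<in>Poly_Mapping.keys f. Poly_Mapping.lookup (r *\<^sub>R f) p *\<^sub>R h p)"
    by (rule free_extension_superset) (auto simp: in_keys_iff lookup_scaleR)
  then show "free_extension h (r *\<^sub>R f) = r *\<^sub>R free_extension h f"
    by (simp add: free_extension_def lookup_scaleR scaleR_sum_right)
qed

lemma free_extension_single [simp]: "free_extension h (Poly_Mapping.single p 1) = h p"
  by (simp add: free_extension_def)

lemma tensor_universal_property:
  fixes b :: "'a::real_vector \<Rightarrow> 'b::real_vector \<Rightarrow> 'c::real_vector"
  assumes "bilinear b"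
  obtains L where "linear L" "\<And>x y. L (elem_tensor x y) = b x y"
proof -
  let ?e = "free_extension (\<lambda>(x, y). b x y)"
  note lin = linear_free_extension[of "\<lambda>(x, y). b x y"]
  have "?e g = 0" if "g \<in> bilinear_relations" for g
    using that
    by (auto simp: bilinear_relations_def linear_diff[OF lin] linear_cmul[OF lin]
        bilinear_ladd[OF assms] bilinear_radd[OF assms]
        bilinear_lmul[OF assms] bilinear_rmul[OF assms])
  then have "?e g = 0" if "g \<in> span bilinear_relations" for g
    using linear_eq_0_on_span[OF lin _ that] by blast
  then have resp: "?e f = ?e g" if "f - g \<in> span bilinear_relations" for f g
    using that linear_diff[OF lin, of f g] by force
  define L where "L z = ?e (rep_tensor z)" for z
  have L: "L (abs_tensor f) = ?e f" for f
    unfolding L_def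
    by (rule resp, rule Quotient3_rep_abs[OF Quotient3_tensor]) (simp add: span_zero)
  have "linear L"
  proof (rule linearI)
    fix z w :: "('a, 'b) tensor" and r :: real
    show "L (z + w) = L z + L w"
      by (induction z rule: tensor.abs_induct, induction w rule: tensor.abs_induct)
        (simp add: plus_tensor.abs_eq L linear_add[OF lin])
    show "L (r *\<^sub>R z) = r *\<^sub>R L z"
      by (induction z rule: tensor.abs_induct)
        (simp add: scaleR_tensor.abs_eq L linear_cmul[OF lin])
  qed
  moreover have "L (elem_tensor x y) = b x y" for x y
    by (simp add: elem_tensor.abs_eq L)
  ultimately show ?thesis by (rule that)
qed

text \<open>
  The operator \<open>T \<otimes> Id\<close>. Its norm is controlled because it turns every representation of \<open>z\<close> into
  one of its image, and the cost of a representation grows by a factor of at most \<open>\<parallel>T\<parallel>\<close>.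
\<close>

lemma tensor_map_left:
  fixes T :: "'a::real_normed_vector \<Rightarrow>\<^sub>L 'c::real_normed_vector"
  obtains L :: "('a, 'b::real_normed_vector) tensor \<Rightarrow> ('c, 'b) tensor"
  where "linear L" "\<And>x y. L (elem_tensor x y) = elem_tensor (T x) y"
    "\<And>z. proj_norm (L z) \<le> norm T * proj_norm z"
proof -
  have "bilinear (\<lambda>x y. elem_tensor (T x) y :: ('c, 'b) tensor)"
    unfolding bilinear_def
    by (auto intro!: linearI simp: blinfun.add_right blinfun.scaleR_right elem_tensor_add_left
        elem_tensor_add_right elem_tensor_scaleR_left elem_tensor_scaleR_right)
  then obtain L :: "('a, 'b) tensor \<Rightarrow> ('c, 'b) tensor" where L: "linear L"
    "\<And>x y. L (elem_tensor x y) = elem_tensor (T x) y"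
    by (rule tensor_universal_property) blast
  have "proj_norm (L z) \<le> norm T * proj_norm z" for z
  proof (rule field_le_epsilon)
    fix e :: real assume "e > 0"
    then have "e / (norm T + 1) > 0" by (simp add: add_nonneg_pos)
    then obtain ps where z: "z = (\<Sum>(x, y)\<leftarrow>ps. elem_tensor x y)"
      and ps: "(\<Sum>(x, y)\<leftarrow>ps. norm x * norm y) < proj_norm z + e / (norm T + 1)"
      using proj_norm_approx by blast
    let ?qs = "map (\<lambda>(x, y). (T x, y)) ps"
    have "L z = (\<Sum>(x, y)\<leftarrow>?qs. elem_tensor x y)"
      unfolding z by (induction ps) (auto simp: L linear_0 linear_add)
    then have "proj_norm (L z) \<le> (\<Sum>(x, y)\<leftarrow>?qs. norm x * norm y)" by (rule proj_norm_le)
    also have "\<dots> \<le> norm T * (\<Sum>(x, y)\<leftarrow>ps. norm x * norm y)"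
      by (induction ps)
        (auto simp: distrib_left mult.assoc[symmetric] intro!: add_mono mult_right_mono norm_blinfun)
    also have "\<dots> \<le> norm T * (proj_norm z + e / (norm T + 1))"
      using ps by (intro mult_left_mono) auto
    also have "\<dots> = norm T * proj_norm z + e * (norm T / (norm T + 1))"
      by (simp add: distrib_left)
    also have "\<dots> \<le> norm T * proj_norm z + e"
      using \<open>e > 0\<close> by (intro add_left_mono mult_left_le) (auto simp: pos_divide_le_eq add_nonneg_pos)
    finally show "proj_norm (L z) \<le> norm T * proj_norm z + e" .
  qed
  with L show ?thesis by (rule that)
qed

section \<open>The weak operator Daugavet property for finitely many vectors\<close>

text \<open>
  By homogeneity the vectors to be almost fixed need not lie on the sphere: normalise the non-zero
  ones and shrink \<open>\<epsilon>\<close> by a factor that exceeds their norms.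
\<close>

lemma WODP_finite:
  fixes f :: "'a::banach \<Rightarrow> real"
  assumes "WODP TYPE('a)" and nontrivial: "\<exists>x :: 'a. x \<noteq> 0"
    and "finite F" "bounded_linear f" "\<epsilon> > 0" "\<alpha> > 0" "norm z' \<le> 1"
  obtains z and T :: "'a \<Rightarrow>\<^sub>L 'a" where "norm z \<le> 1" "\<And>x. norm x \<le> 1 \<Longrightarrow> f x - \<alpha> < f z"
    "norm T \<le> 1 + \<epsilon>" "\<And>v. v \<in> F \<Longrightarrow> norm (T v - v) < \<epsilon>" "norm (T z - z') < \<epsilon>"
proof -
  obtain x0 :: 'a where "x0 \<noteq> 0" using nontrivial by blast
  \<comment> \<open>The extra vector \<open>sgn x0\<close> keeps the list of unit vectors non-empty when \<open>F \<subseteq> {0}\<close>.\<close>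
  let ?G = "insert (sgn x0) (sgn ` (F - {0}))"
  obtain vs where vs: "set vs = ?G" using assms(3) finite_list[of ?G] by auto
  define zs where "zs i = vs ! (i - 1)" for i
  have "vs \<noteq> []" using vs by auto
  have G: "?G = zs ` {1..length vs}"
  proof -
    have "?G = (!) vs ` {..<length vs}" using vs nth_image[of "length vs" vs] by (simp add: lessThan_atLeast0)
    also have "\<dots> = zs ` {1..length vs}"
      unfolding zs_def by (force simp: image_iff Bex_def intro: exI[of _ "Suc _"])
    finally show ?thesis .
  qed
  define M where "M = 1 + (\<Sum>v\<in>F. norm v)"
  have M: "M \<ge> 1" by (simp add: M_def sum_nonneg)
  have e: "\<epsilon> / M > 0" "\<epsilon> / M \<le> \<epsilon>"
    using M \<open>\<epsilon> > 0\<close> by (auto simp: pos_divide_le_eq)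
  define g where "g = Blinfun f"
  have g: "blinfun_apply g = f" unfolding g_def by (rule bounded_linear_Blinfun_apply) fact
  have 1: "1 \<le> length vs" using \<open>vs \<noteq> []\<close> by (cases vs) auto
  have sph: "\<forall>i\<in>{1..length vs}. zs i \<in> sphere 0 1"
  proof -
    have "\<forall>v\<in>?G. v \<in> sphere 0 1" using \<open>x0 \<noteq> 0\<close> by (auto simp: norm_sgn)
    then show ?thesis unfolding G by blast
  qed
  obtain z and T :: "'a \<Rightarrow>\<^sub>L 'a" where z: "z \<in> slice g \<alpha>"
    and T: "norm T \<le> 1 + \<epsilon> / M" "\<forall>i\<in>{1..length vs}. norm (T (zs i) - zs i) < \<epsilon> / M"
      "norm (T z - z') < \<epsilon> / M"
    using assms(1)[unfolded WODP_def, rule_format, OF 1, of zs "\<epsilon> / M" \<alpha> z' g]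
      sph e \<open>\<alpha> > 0\<close> \<open>norm z' \<le> 1\<close> by auto
  show ?thesis
  proof (rule that)
    show "norm z \<le> 1" using z by (simp add: slice_def)
    show "f x - \<alpha> < f z" if "norm x \<le> 1" for x
    proof -
      have "bdd_above (f ` cball 0 1)"
      proof (rule bdd_aboveI2)
        fix x :: 'a assume "x \<in> cball 0 1"
        then have "norm g * norm x \<le> norm g * 1" by (intro mult_left_mono) auto
        then show "f x \<le> norm g" using norm_blinfun[of g x] by (simp add: g)
      qed
      then have "f x \<le> (SUP x\<in>cball 0 1. f x)" using that by (intro cSUP_upper) auto
      with z show ?thesis by (simp add: slice_def g)
    qed
    show "norm T \<le> 1 + \<epsilon>" "norm (T z - z') < \<epsilon>" using T e by linarith+
    show "norm (T v - v) < \<epsilon>" if "v \<in> F" for v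
    proof (cases "v = 0")
      case False
      with that have "sgn v \<in> ?G" by auto
      then have *: "norm (T (sgn v) - sgn v) < \<epsilon> / M" unfolding G using T(2) by auto
      have "T v - v = norm v *\<^sub>R (T (sgn v) - sgn v)"
        using False by (simp add: sgn_div_norm blinfun.scaleR_right scaleR_diff_right)
      then have "norm (T v - v) = norm v * norm (T (sgn v) - sgn v)" by simp
      also have "\<dots> < norm v * (\<epsilon> / M)"
        using * False by (intro mult_strict_left_mono) auto
      also have "\<dots> \<le> M * (\<epsilon> / M)"
        using member_le_sum[of v F norm] that \<open>finite F\<close> e(1)
        by (intro mult_right_mono) (auto simp: M_def)
      also have "\<dots> = \<epsilon>" using M by simp
      finally show ?thesis .
    qed (simp add: \<open>\<epsilon> > 0\<close>)
  qed
qed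

section \<open>Steering the reflected vectors\<close>

text \<open>
  The entries \<open>u\<close> play the part of \<open>- x\<close> as far as \<open>T\<close> is concerned, yet the forms \<open>B j\<close> hardly
  distinguish them from \<open>x\<close>. The induction adds one vector at a time; it works because the bound
  on the squared error is additive along the list, which the choice of the slice guarantees: the
  mixed term of the square is made at most \<open>\<alpha>\<close>, and the square of the new error is at most of
  the order of \<open>(K * norm x * norm y)\<^sup>2\<close> for each form.
\<close>

lemma WODP_reflection:
  fixes B :: "'j \<Rightarrow> 'a::banach \<Rightarrow> 'b::real_normed_vector \<Rightarrow> real"
  assumes "WODP TYPE('a)" and "\<exists>x :: 'a. x \<noteq> 0"
    and "finite J" and B: "\<And>j. j \<in> J \<Longrightarrow> bounded_bilinear (B j)"
    and K: "\<And>j x y. j \<in> J \<Longrightarrow> \<bar>B j x y\<bar> \<le> K * (norm x * norm y)"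
    and "0 \<le> K" "\<alpha> > 0" "\<epsilon> > 0" "finite F"
  shows "\<exists>ts (T :: 'a \<Rightarrow>\<^sub>L 'a). map (\<lambda>(x, u, y). (x, y)) ts = qs \<and> norm T \<le> 1 + \<epsilon> \<and>
    (\<forall>v\<in>F. norm (blinfun_apply T v - v) < \<epsilon>) \<and>
    (\<forall>(x, u, y)\<in>set ts. norm u \<le> norm x \<and> norm (blinfun_apply T u + x) < \<epsilon>) \<and>
    (\<Sum>j\<in>J. (\<Sum>(x, u, y)\<leftarrow>ts. B j (u - x) y)\<^sup>2)
      \<le> (\<Sum>(x, y)\<leftarrow>qs. \<alpha> + real (card J) * (2 * K * (norm x * norm y))\<^sup>2)"
  using assms(8,9)
proof (induction qs arbitrary: F \<epsilon>)
  case Nil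
  show ?case
    by (rule exI[of _ "[]"], rule exI[of _ "id_blinfun"])
      (use Nil norm_blinfun_id_le[where 'a='a] in auto)
next
  case (Cons q qs)
  obtain x y where q: "q = (x, y)" by fastforce
  define \<delta> where "\<delta> = min \<epsilon> 1 / 3"
  have \<delta>: "\<delta> > 0" "\<delta> \<le> 1 / 3" "3 * \<delta> \<le> \<epsilon>" using Cons.prems by (auto simp: \<delta>_def)
  have \<delta>\<delta>: "\<delta> * \<delta> \<le> \<delta>" using \<delta> mult_left_le[of \<delta> \<delta>] by simp
  obtain ts and T1 :: "'a \<Rightarrow>\<^sub>L 'a" where ts: "map (\<lambda>(x, u, y). (x, y)) ts = qs"
    and T1: "norm T1 \<le> 1 + \<delta>" "\<And>v. v \<in> insert x F \<Longrightarrow> norm (T1 v - v) < \<delta>"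
    and u': "\<And>x u y. (x, u, y) \<in> set ts \<Longrightarrow> norm u \<le> norm x \<and> norm (T1 u + x) < \<delta>"
    and err: "(\<Sum>j\<in>J. (\<Sum>(x, u, y)\<leftarrow>ts. B j (u - x) y)\<^sup>2)
      \<le> (\<Sum>(x, y)\<leftarrow>qs. \<alpha> + real (card J) * (2 * K * (norm x * norm y))\<^sup>2)"
    using Cons.IH[OF \<delta>(1), of "insert x F"] Cons.prems by blast
  \<comment> \<open>To first order, replacing \<open>x\<close> by a \<open>u\<close> with larger value of \<open>f\<close> decreases the sum of
    the squares of the errors \<open>s\<close>.\<close>
  define s where "s j = (\<Sum>(x, u, y)\<leftarrow>ts. B j (u - x) y)" for j
  define f where "f v = - (\<Sum>j\<in>J. 2 * s j * B j v y)" for v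
  have f: "bounded_linear f"
    unfolding f_def
    by (intro bounded_linear_minus bounded_linear_sum bounded_linear_const_mult
        bounded_bilinear.bounded_linear_left[OF B])
  have "\<delta> / (norm x + 1) > 0" "\<alpha> / (norm x + 1) > 0" 
    using \<delta> \<open>\<alpha> > 0\<close> by (simp_all add: add_nonneg_pos)
  moreover have "norm (- sgn x) \<le> 1" by (simp add: norm_sgn)
  ultimately obtain z and T2 :: "'a \<Rightarrow>\<^sub>L 'a" where z: "norm z \<le> 1"
    "\<And>x'. norm x' \<le> 1 \<Longrightarrow> f x' - \<alpha> / (norm x + 1) < f z"
    and T2: "norm T2 \<le> 1 + \<delta> / (norm x + 1)"
    "\<And>v. v \<in> F \<union> (\<lambda>(x, u, y). u) ` set ts \<Longrightarrow> norm (T2 v - v) < \<delta> / (norm x + 1)"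
    "norm (T2 z - - sgn x) < \<delta> / (norm x + 1)"
    using WODP_finite[OF assms(1,2) _ f, of "F \<union> (\<lambda>(x, u, y). u) ` set ts"] Cons.prems by blast
  have small: "norm x * (c / (norm x + 1)) \<le> c" "c / (norm x + 1) \<le> c" if "c > 0" for c :: real
  proof -
    have "0 < norm x + 1" by (simp add: add_nonneg_pos)
    then show "norm x * (c / (norm x + 1)) \<le> c" "c / (norm x + 1) \<le> c"
      using that by (auto simp: pos_divide_le_eq field_simps)
  qed
  have T2_fixes: "norm (T2 v - v) \<le> \<delta>" if "v \<in> F \<union> (\<lambda>(x, u, y). u) ` set ts" for v
    using T2(2)[OF that] small(2)[OF \<delta>(1)] by linarith
  have xs: "x = norm x *\<^sub>R sgn x" by (cases "x = 0") (simp_all add: sgn_div_norm)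
  define u where "u = norm x *\<^sub>R z"
  define T where "T = T1 o\<^sub>L T2"
  have nu: "norm u \<le> norm x" using z(1) by (simp add: u_def mult_left_le)
  have T2u: "norm (T2 u + x) \<le> \<delta>"
  proof -
    have "T2 u + x = norm x *\<^sub>R (T2 z - - sgn x)"
      by (simp add: u_def blinfun.scaleR_right scaleR_add_right flip: xs)
    then have "norm (T2 u + x) = norm x * norm (T2 z - - sgn x)" by simp
    also have "\<dots> \<le> norm x * (\<delta> / (norm x + 1))" using T2(3) by (intro mult_left_mono) auto
    also have "\<dots> \<le> \<delta>" by (rule small) fact
    finally show ?thesis .
  qed
  \<comment> \<open>\<open>T2\<close> leads from \<open>v\<close> to \<open>w\<close> and \<open>T1\<close> from \<open>w\<close> to \<open>c\<close>. This is used with \<open>v = w = c\<close> in \<open>F\<close>,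
    with \<open>w = c = - x\<close> for the new \<open>u\<close>, and with \<open>v = w\<close> for the old ones.\<close>
  have comp: "norm (T v - c) < \<epsilon>" if "norm (T2 v - w) \<le> \<delta>" "norm (T1 w - c) < \<delta>" for v w c
  proof -
    have "T v - c = T1 (T2 v - w) + (T1 w - c)" by (simp add: T_def blinfun.diff_right)
    then have "norm (T v - c) \<le> norm (T1 (T2 v - w)) + norm (T1 w - c)"
      by (simp only: norm_triangle_ineq)
    moreover have "norm (T1 (T2 v - w)) \<le> (1 + \<delta>) * \<delta>"
      by (rule order_trans[OF norm_blinfun mult_mono]) (use T1 that \<delta> in auto)
    moreover have "(1 + \<delta>) * \<delta> = \<delta> + \<delta> * \<delta>" by (simp add: distrib_right)
    ultimately show ?thesis using \<delta> \<delta>\<delta> that(2) by linarith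
  qed
  have step: "f (sgn x) * norm x - \<alpha> \<le> f z * norm x"
  proof -
    have "norm x * f (sgn x) - norm x * (\<alpha> / (norm x + 1)) \<le> norm x * f z"
      using mult_left_mono[OF less_imp_le[OF z(2)[of "sgn x"]], of "norm x"]
      by (simp add: norm_sgn right_diff_distrib)
    with small(1)[OF \<open>\<alpha> > 0\<close>] show ?thesis by (simp add: mult.commute)
  qed
  have fscale: "f (r *\<^sub>R v) = r * f v" for r v
    using linear_cmul[OF bounded_linear.linear[OF f]] by simp
  \<comment> \<open>The slice was taken for \<open>sgn x\<close>; scaling by \<open>norm x\<close> carries the inequality over to \<open>x\<close>.\<close>
  have "f x - \<alpha> \<le> f u"
    using step by (subst xs) (simp add: fscale u_def mult.commute)
  then have lin: "(\<Sum>j\<in>J. 2 * s j * B j (u - x) y) \<le> \<alpha>"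
    using linear_diff[OF bounded_linear.linear[OF f], of u x] by (simp add: f_def)
  have quad: "(\<Sum>j\<in>J. (B j (u - x) y)\<^sup>2) \<le> real (card J) * (2 * K * (norm x * norm y))\<^sup>2"
  proof (rule sum_bounded_above)
    fix j assume j: "j \<in> J"
    have "norm (u - x) \<le> 2 * norm x" using norm_triangle_ineq4[of u x] nu by linarith
    then have "norm (u - x) * norm y \<le> 2 * norm x * norm y" by (rule mult_right_mono) simp
    from mult_left_mono[OF this \<open>0 \<le> K\<close>]
    have "K * (norm (u - x) * norm y) \<le> 2 * K * (norm x * norm y)" by (simp add: mult_ac)
    then have "\<bar>B j (u - x) y\<bar> \<le> 2 * K * (norm x * norm y)" using K[OF j, of "u - x" y] by linarith
    then show "(B j (u - x) y)\<^sup>2 \<le> (2 * K * (norm x * norm y))\<^sup>2"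
      by (metis abs_ge_zero power2_abs power_mono)
  qed
  have sq: "(\<Sum>j\<in>J. (B j (u - x) y + s j)\<^sup>2)
      = (\<Sum>j\<in>J. (B j (u - x) y)\<^sup>2) + (\<Sum>j\<in>J. 2 * s j * B j (u - x) y) + (\<Sum>j\<in>J. (s j)\<^sup>2)"
    by (simp add: power2_sum sum.distrib algebra_simps)
  show ?case
  proof (rule exI[of _ "(x, u, y) # ts"], rule exI[of _ T], intro conjI)
    show "map (\<lambda>(x, u, y). (x, y)) ((x, u, y) # ts) = q # qs" using ts q by simp
    have "norm T \<le> (1 + \<delta>) * (1 + \<delta>)"
      unfolding T_def
      by (rule order_trans[OF norm_blinfun_compose mult_mono])
        (use T1 T2 \<delta> small(2)[OF \<delta>(1)] in auto)
    also have "\<dots> = 1 + 2 * \<delta> + \<delta> * \<delta>" by (simp add: algebra_simps)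
    finally show "norm T \<le> 1 + \<epsilon>" using \<delta> \<delta>\<delta> by linarith
    show "\<forall>v\<in>F. norm (T v - v) < \<epsilon>"
    proof
      fix v assume "v \<in> F"
      then show "norm (T v - v) < \<epsilon>" using T1(2)[of v] T2_fixes[of v] by (intro comp) auto
    qed
    have "norm (T u - - x) < \<epsilon>"
      using T2u T1(2)[of x] by (intro comp[of _ "- x"]) (simp_all add: blinfun.minus_right norm_minus_commute)
    moreover have "norm (T u' - - x') < \<epsilon>" if "(x', u', y') \<in> set ts" for x' u' y'
    proof (rule comp)
      have "u' \<in> (\<lambda>(x, u, y). u) ` set ts" using that by force
      then show "norm (T2 u' - u') \<le> \<delta>" using T2_fixes by blast
      show "norm (T1 u' - - x') < \<delta>" using u'[OF that] by simp
    qed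
    ultimately show "\<forall>(x, u, y)\<in>set ((x, u, y) # ts). norm u \<le> norm x \<and> norm (T u + x) < \<epsilon>"
      using nu u' by auto
    show "(\<Sum>j\<in>J. (\<Sum>(x, u, y)\<leftarrow>(x, u, y) # ts. B j (u - x) y)\<^sup>2)
      \<le> (\<Sum>(x, y)\<leftarrow>q # qs. \<alpha> + real (card J) * (2 * K * (norm x * norm y))\<^sup>2)"
      using lin quad err by (simp add: q sq flip: s_def)
  qed
qed

section \<open>Weak neighbourhoods and representations of tensors\<close>

lemma weak_neighbourhood:
  fixes z :: "'a::real_normed_vector"
  assumes "openin weak_topology U" "z \<in> U"
  shows "\<exists>\<Phi> :: ('a \<Rightarrow>\<^sub>L real) set. \<exists>\<delta>>0. finite \<Phi> \<and>
    {w. \<forall>\<phi>\<in>\<Phi>. \<bar>blinfun_apply \<phi> w - blinfun_apply \<phi> z\<bar> < \<delta>} \<subseteq> U"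
proof -
  have "generate_topology_on {blinfun_apply f -` V | (f :: 'a \<Rightarrow>\<^sub>L real) V. open V} U"
    using assms(1) by (simp add: weak_topology_def openin_topology_generated_by_iff)
  then show ?thesis
    using assms(2)
  proof (induction rule: generate_topology_on.induct)
    case (Int U V)
    from Int.prems have "z \<in> U" "z \<in> V" by auto
    with Int.IH obtain \<Phi> \<Psi> :: "('a \<Rightarrow>\<^sub>L real) set" and \<delta> \<epsilon> :: real
      where \<Phi>: "\<delta> > 0" "finite \<Phi>"
        "{w. \<forall>\<phi>\<in>\<Phi>. \<bar>blinfun_apply \<phi> w - blinfun_apply \<phi> z\<bar> < \<delta>} \<subseteq> U"
      and \<Psi>: "\<epsilon> > 0" "finite \<Psi>"
        "{w. \<forall>\<phi>\<in>\<Psi>. \<bar>blinfun_apply \<phi> w - blinfun_apply \<phi> z\<bar> < \<epsilon>} \<subseteq> V"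
      by blast
    have "{w. \<forall>\<phi>\<in>\<Phi> \<union> \<Psi>. \<bar>blinfun_apply \<phi> w - blinfun_apply \<phi> z\<bar> < min \<delta> \<epsilon>} \<subseteq> U \<inter> V"
      using \<Phi>(3) \<Psi>(3) by auto
    then show ?case using \<Phi>(1,2) \<Psi>(1,2)
      by (intro exI[of _ "\<Phi> \<union> \<Psi>"] exI[of _ "min \<delta> \<epsilon>"]) simp
  next
    case (UN \<U>)
    then obtain V where V: "V \<in> \<U>" "z \<in> V" by blast
    have "V \<subseteq> \<Union>\<U>" using V by blast
    with UN.IH[OF V] show ?case by (meson order.trans)
  next
    case (Basis U)
    then obtain f :: "'a \<Rightarrow>\<^sub>L real" and V where U: "U = f -` V" "open V" by blast
    then obtain \<delta> where \<delta>: "\<delta> > 0" "ball (f z) \<delta> \<subseteq> V"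
      using Basis.prems open_contains_ball_eq by blast
    have "{w. \<forall>\<phi>\<in>{f}. \<bar>blinfun_apply \<phi> w - blinfun_apply \<phi> z\<bar> < \<delta>} \<subseteq> U"
      using \<delta>(2) by (auto simp: U dist_real_def abs_minus_commute subset_eq)
    then show ?case using \<delta>(1) by blast
  qed simp
qed

text \<open>
  A nearby algebraic tensor may have norm slightly above \<open>1\<close>, and an efficient representation of it
  is slightly more expensive still. Dividing by \<open>1 + \<delta>\<close> brings the norm strictly below \<open>1\<close> and
  leaves room for a representation of cost at most \<open>1\<close>.
\<close>

lemma proj_tensor_approx:
  fixes z :: "('a::real_normed_vector, 'b::real_normed_vector) proj_tensor"
  assumes "norm z \<le> 1" "\<eta> > 0"
  obtains ps where "(\<Sum>(x, y)\<leftarrow>ps. norm x * norm y) \<le> 1"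
    "norm (z - of_tensor (\<Sum>(x, y)\<leftarrow>ps. elem_tensor x y)) < \<eta>"
proof -
  define \<delta> where "\<delta> = \<eta> / 2"
  have \<delta>: "\<delta> > 0" using assms by (simp add: \<delta>_def)
  have "z \<in> closure (range of_tensor)" by (simp add: of_tensor_dense)
  then obtain t where t: "norm (z - of_tensor t) < \<delta>"
    using \<delta> by (fastforce simp: closure_approachable dist_norm norm_minus_commute)
  then have nt: "proj_norm t < 1 + \<delta>"
    using assms(1) norm_triangle_ineq2[of "of_tensor t" z] by (simp add: norm_of_tensor norm_minus_commute)
  define t' where "t' = (1 / (1 + \<delta>)) *\<^sub>R t"
  have "proj_norm t' < 1" using nt \<delta> by (simp add: t'_def proj_norm_scaleR)
  then obtain ps where ps: "t' = (\<Sum>(x, y)\<leftarrow>ps. elem_tensor x y)"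
    "(\<Sum>(x, y)\<leftarrow>ps. norm x * norm y) < 1"
    using proj_norm_approx[of "1 - proj_norm t'" t'] by auto
  have "t - t' = (\<delta> / (1 + \<delta>)) *\<^sub>R t"
  proof -
    have "t - t' = (1 - 1 / (1 + \<delta>)) *\<^sub>R t" by (simp add: t'_def scaleR_diff_left)
    also have "1 - 1 / (1 + \<delta>) = \<delta> / (1 + \<delta>)" using \<delta> by (simp add: field_simps)
    finally show ?thesis .
  qed
  then have "proj_norm (t - t') = \<delta> / (1 + \<delta>) * proj_norm t" using \<delta> by (simp add: proj_norm_scaleR)
  also have "\<dots> \<le> \<delta> / (1 + \<delta>) * (1 + \<delta>)" using nt \<delta> by (intro mult_left_mono) auto
  also have "\<dots> = \<delta>" using \<delta> by simp
  finally have "norm (of_tensor t - of_tensor t') \<le> \<delta>"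
    by (simp add: norm_of_tensor flip: linear_diff[OF linear_of_tensor])
  with t norm_triangle_ineq[of "z - of_tensor t" "of_tensor t - of_tensor t'"]
  have "norm (z - of_tensor t') < \<eta>" by (simp add: \<delta>_def)
  with ps show ?thesis by (intro that[of ps]) auto
qed

text \<open>
  Writing \<open>x \<otimes> y\<close> as \<open>N\<close> copies of \<open>(x / N) \<otimes> y\<close> changes neither the tensor nor the cost of the
  representation, but divides the sum of the squared costs by \<open>N\<close>.
\<close>

lemma tensor_representation_refine:
  fixes ps :: "('a::real_normed_vector \<times> 'b::real_normed_vector) list"
  assumes "\<eta> > 0"
  obtains qs where "(\<Sum>(x, y)\<leftarrow>qs. elem_tensor x y) = (\<Sum>(x, y)\<leftarrow>ps. elem_tensor x y)"
    "(\<Sum>(x, y)\<leftarrow>qs. norm x * norm y) = (\<Sum>(x, y)\<leftarrow>ps. norm x * norm y)"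
    "(\<Sum>(x, y)\<leftarrow>qs. (norm x * norm y)\<^sup>2) < \<eta>"
proof -
  let ?S = "\<Sum>(x, y)\<leftarrow>ps. (norm x * norm y)\<^sup>2"
  obtain N :: nat where N: "?S / \<eta> < N" using reals_Archimedean2 by blast
  have "0 \<le> ?S" by (rule sum_list_nonneg) auto
  with N assms have "N > 0" by (metis divide_nonneg_pos not_gr_zero of_nat_0 not_less)
  let ?rs = "map (\<lambda>(x, y). (x /\<^sub>R real N, y)) ps"
  define qs where "qs = concat (replicate N ?rs)"
  have "(\<Sum>(x, y)\<leftarrow>concat (replicate M ?rs). h x y) = real M *\<^sub>R (\<Sum>(x, y)\<leftarrow>?rs. h x y)"
    for h :: "'a \<Rightarrow> 'b \<Rightarrow> 'c::real_vector" and M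
    by (induction M) (simp_all add: scaleR_add_left)
  note copies = this[of _ N, folded qs_def]
  have "(\<Sum>(x, y)\<leftarrow>?rs. elem_tensor x y) = (\<Sum>(x, y)\<leftarrow>ps. elem_tensor x y) /\<^sub>R real N"
    by (induction ps) (auto simp: elem_tensor_scaleR_left scaleR_add_right)
  then have 1: "(\<Sum>(x, y)\<leftarrow>qs. elem_tensor x y) = (\<Sum>(x, y)\<leftarrow>ps. elem_tensor x y)"
    using \<open>N > 0\<close> by (simp only: copies) simp
  have "(\<Sum>(x, y)\<leftarrow>?rs. norm x * norm y) = (\<Sum>(x, y)\<leftarrow>ps. norm x * norm y) / real N"
    by (induction ps) (auto simp: divide_simps)
  then have 2: "(\<Sum>(x, y)\<leftarrow>qs. norm x * norm y) = (\<Sum>(x, y)\<leftarrow>ps. norm x * norm y)"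
    using \<open>N > 0\<close> by (simp only: copies) simp
  have "(\<Sum>(x, y)\<leftarrow>?rs. (norm x * norm y)\<^sup>2) = ?S / (real N)\<^sup>2"
    by (induction ps) (auto simp: field_simps add_divide_distrib)
  then have "(\<Sum>(x, y)\<leftarrow>qs. (norm x * norm y)\<^sup>2) = ?S / real N"
    using \<open>N > 0\<close> by (simp only: copies) (simp add: power2_eq_square field_simps)
  moreover have "?S / real N < \<eta>"
    using N assms \<open>N > 0\<close> by (simp add: pos_divide_less_eq mult.commute)
  ultimately have "(\<Sum>(x, y)\<leftarrow>qs. (norm x * norm y)\<^sup>2) < \<eta>" by simp
  with 1 2 show ?thesis by (rule that)
qed


section \<open>Almost diametral tensors\<close>

lemma elem_tensor_diff_left: "elem_tensor (x - x') y = elem_tensor x y - elem_tensor x' y"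
  using elem_tensor_add_left[of "x - x'" x' y] by simp

text \<open>
  Apply \<open>T \<otimes> Id\<close> to \<open>v - t\<close>: the result differs from \<open>- 2 t\<close> by \<open>\<Sum> (T u + x) \<otimes> y + \<Sum> (x - T x) \<otimes> y\<close>,
  which is small.
\<close>

lemma reflection_far:
  fixes T :: "'a::real_normed_vector \<Rightarrow>\<^sub>L 'a" and ts :: "('a \<times> 'a \<times> 'b::real_normed_vector) list"
  defines "t \<equiv> (\<Sum>(x, u, y)\<leftarrow>ts. elem_tensor x y)"
    and "v \<equiv> (\<Sum>(x, u, y)\<leftarrow>ts. elem_tensor u y)"
  assumes "\<And>x u y. (x, u, y) \<in> set ts \<Longrightarrow>
    norm (blinfun_apply T u + x) \<le> e \<and> norm (blinfun_apply T x - x) \<le> e"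
  shows "2 * proj_norm t \<le> norm T * proj_norm (v - t) + 2 * e * (\<Sum>(x, u, y)\<leftarrow>ts. norm y)"
proof -
  obtain L :: "('a, 'b) tensor \<Rightarrow> ('a, 'b) tensor"
    where L: "linear L" "\<And>x y. L (elem_tensor x y) = elem_tensor (T x) y"
    "\<And>z. proj_norm (L z) \<le> norm T * proj_norm z"
    using tensor_map_left[of T] by blast
  let ?qs = "\<lambda>ts. map (\<lambda>(x, u, y). (T u + x, y)) ts @ map (\<lambda>(x, u, y). (x - T x, y)) ts"
  have "L (v - t) + 2 *\<^sub>R t = (\<Sum>(x, y)\<leftarrow>?qs ts. elem_tensor x y)"
    unfolding t_def v_def
    by (induction ts) (auto simp: L linear_0 linear_add linear_diff elem_tensor_add_left
        elem_tensor_diff_left scaleR_2 algebra_simps)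
  then have "proj_norm (L (v - t) + 2 *\<^sub>R t) \<le> (\<Sum>(x, y)\<leftarrow>?qs ts. norm x * norm y)"
    by (rule proj_norm_le)
  also have "\<dots> \<le> 2 * e * (\<Sum>(x, u, y)\<leftarrow>ts. norm y)"
    using assms(3)
  proof (induction ts)
    case (Cons p ts)
    obtain x u y where p: "p = (x, u, y)" by (cases p)
    have "norm (T u + x) * norm y \<le> e * norm y" "norm (x - T x) * norm y \<le> e * norm y"
      using Cons.prems[of x u y] by (auto simp: p norm_minus_commute intro!: mult_right_mono)
    moreover have "(\<Sum>(x, y)\<leftarrow>?qs ts. norm x * norm y) \<le> 2 * e * (\<Sum>(x, u, y)\<leftarrow>ts. norm y)"
      by (rule Cons.IH) (use Cons.prems in auto)
    ultimately show ?case by (simp add: p distrib_left)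
  qed simp
  finally have "proj_norm (L (v - t) + 2 *\<^sub>R t) \<le> 2 * e * (\<Sum>(x, u, y)\<leftarrow>ts. norm y)" .
  moreover have "2 * proj_norm t \<le> proj_norm (L (v - t) + 2 *\<^sub>R t) + proj_norm (L (v - t))"
    using proj_norm_triangle[of "L (v - t) + 2 *\<^sub>R t" "- L (v - t)"]
    by (simp add: proj_norm_scaleR)
  ultimately show ?thesis using L(3)[of "v - t"] by linarith
qed

text \<open>
  A functional on the tensor product is a bounded bilinear form on the factors, so that finitely
  many of them can serve as the forms in \<open>WODP_reflection\<close>.
\<close>

lemma
  fixes \<phi> :: "('a::real_normed_vector, 'b::real_normed_vector) proj_tensor \<Rightarrow>\<^sub>L real"
  shows functional_elem_tensor_le:
      "\<bar>\<phi> (of_tensor (elem_tensor x y))\<bar> \<le> norm \<phi> * (norm x * norm y)"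
    and bounded_bilinear_functional: "bounded_bilinear (\<lambda>x y. \<phi> (of_tensor (elem_tensor x y)))"
proof -
  note lin = linear_of_tensor[where 'a='a and 'b='b]
  have *: "\<bar>\<phi> (of_tensor (elem_tensor x y))\<bar> \<le> norm \<phi> * (norm x * norm y)" for x y
  proof -
    have "proj_norm (elem_tensor x y) \<le> norm x * norm y"
      using proj_norm_le[of _ "[(x, y)]"] by simp
    then have "norm \<phi> * norm (of_tensor (elem_tensor x y)) \<le> norm \<phi> * (norm x * norm y)"
      by (intro mult_left_mono) (simp_all add: norm_of_tensor)
    with norm_blinfun[of \<phi> "of_tensor (elem_tensor x y)"] show ?thesis by simp
  qed
  then show "\<bar>\<phi> (of_tensor (elem_tensor x y))\<bar> \<le> norm \<phi> * (norm x * norm y)" .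
  show "bounded_bilinear (\<lambda>x y. \<phi> (of_tensor (elem_tensor x y)))"
    by standard
      (use * in \<open>auto simp: elem_tensor_add_left elem_tensor_add_right elem_tensor_scaleR_left
        elem_tensor_scaleR_right linear_add[OF lin] linear_cmul[OF lin] blinfun.add_right
        blinfun.scaleR_right mult_ac intro!: exI[of _ "norm \<phi>"]\<close>)
qed

theorem theorem4p3:
  assumes "\<exists>x :: 'a::banach. x \<noteq> 0"
    and "WODP TYPE('a)"
    and "\<exists>y :: 'b::banach. y \<noteq> 0"
  shows "DD2P TYPE(('a, 'b) proj_tensor)"
  unfolding DD2P_def
proof (intro allI impI, elim conjE)
  fix W :: "('a, 'b) proj_tensor set" and z and \<epsilon> :: real
  assume W: "openin (subtopology weak_topology (cball 0 1)) W"
    and "z \<in> W \<inter> sphere 0 1" and \<epsilon>: "\<epsilon> > 0"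
  then have zW: "z \<in> W" and z: "norm z = 1" by auto
  obtain U where U: "openin weak_topology U" "W = U \<inter> cball 0 1"
    using W by (auto simp: openin_subtopology)
  obtain \<Phi> :: "(('a, 'b) proj_tensor \<Rightarrow>\<^sub>L real) set" and \<delta> where "finite \<Phi>" and \<delta>: "\<delta> > 0"
    and nbhd: "{w. \<forall>\<phi>\<in>\<Phi>. \<bar>blinfun_apply \<phi> w - blinfun_apply \<phi> z\<bar> < \<delta>} \<subseteq> U"
    using weak_neighbourhood[OF U(1), of z] zW U(2) by blast
  define K where "K = (\<Sum>\<phi>\<in>\<Phi>. norm \<phi>)"
  have K: "0 \<le> K" "\<And>\<phi>. \<phi> \<in> \<Phi> \<Longrightarrow> norm \<phi> \<le> K"
    using \<open>finite \<Phi>\<close> by (auto simp: K_def sum_nonneg member_le_sum)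
  define \<eta> where "\<eta> = min (\<epsilon> / 6) (\<delta> / (3 * (K + 1)))"
  have "\<eta> > 0" using \<epsilon> \<delta> K by (simp add: \<eta>_def)
  have \<eta>: "3 * \<eta> \<le> \<epsilon> / 2" by (simp add: \<eta>_def)
  have K\<eta>: "K * \<eta> \<le> \<delta> / 3"
  proof -
    have "K * \<eta> \<le> (K + 1) * (\<delta> / (3 * (K + 1)))"
      using K \<open>\<eta> > 0\<close> by (intro mult_mono) (auto simp: \<eta>_def)
    also have "\<dots> = \<delta> / 3" using K by (simp add: field_simps)
    finally show ?thesis .
  qed
  \<comment> \<open>\<open>\<eta>\<close> keeps the loss in norm below \<open>\<epsilon> / 2\<close> and the loss on each functional below \<open>\<delta> / 2\<close>; the
    other half of \<open>\<delta>\<close> is for the steering error. The bounds on \<open>qs\<close> and the choice of \<open>\<alpha>\<close> each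
    contribute \<open>\<delta>\<^sup>2 / 8\<close> to the bound \<open>(\<delta> / 2)\<^sup>2\<close> on its square.\<close>
  obtain ps where ps: "(\<Sum>(x, y)\<leftarrow>ps. norm x * norm y) \<le> 1"
    "norm (z - of_tensor (\<Sum>(x, y)\<leftarrow>ps. elem_tensor x y)) < \<eta>"
    using proj_tensor_approx[of z \<eta>] z \<open>\<eta> > 0\<close> by auto
  define C where "C = real (card \<Phi>) * (2 * K)\<^sup>2"
  have C: "C \<ge> 0" by (simp add: C_def)
  have "\<delta>\<^sup>2 / 8 / (C + 1) > 0" using \<delta> C by (simp add: add_nonneg_pos)
  then obtain qs where qs: "(\<Sum>(x, y)\<leftarrow>qs. elem_tensor x y) = (\<Sum>(x, y)\<leftarrow>ps. elem_tensor x y)"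
    "(\<Sum>(x, y)\<leftarrow>qs. norm x * norm y) = (\<Sum>(x, y)\<leftarrow>ps. norm x * norm y)"
    "(\<Sum>(x, y)\<leftarrow>qs. (norm x * norm y)\<^sup>2) < \<delta>\<^sup>2 / 8 / (C + 1)"
    by (rule tensor_representation_refine)
  define t where "t = (\<Sum>(x, y)\<leftarrow>qs. elem_tensor x y)"
  have t: "norm (z - of_tensor t) < \<eta>" using ps qs by (simp add: t_def)
  define \<alpha> where "\<alpha> = \<delta>\<^sup>2 / 8 / (real (length qs) + 1)"
  have \<alpha>: "\<alpha> > 0" using \<delta> by (simp add: \<alpha>_def add_nonneg_pos)
  define Y where "Y = (\<Sum>(x, y)\<leftarrow>qs. norm y)"
  have Y: "Y \<ge> 0" unfolding Y_def by (rule sum_list_nonneg) auto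
  define e where "e = \<epsilon> / (8 * (Y + 1))"
  have "Y + 1 > 0" using Y by simp
  then have e: "e > 0" "e * (Y + 1) = \<epsilon> / 8" using \<epsilon> by (simp_all add: e_def field_simps)
  define B where "B \<phi> x y = blinfun_apply \<phi> (of_tensor (elem_tensor x y))"
    for \<phi> :: "('a, 'b) proj_tensor \<Rightarrow>\<^sub>L real" and x y
  have "bounded_bilinear (B \<phi>)" for \<phi>
    unfolding B_def by (rule bounded_bilinear_functional)
  moreover have "\<bar>B \<phi> x y\<bar> \<le> K * (norm x * norm y)" if "\<phi> \<in> \<Phi>" for \<phi> x y
    using functional_elem_tensor_le[of \<phi> x y] mult_right_mono[OF K(2)[OF that], of "norm x * norm y"]
    by (simp add: B_def)
  ultimately obtain ts and T :: "'a \<Rightarrow>\<^sub>L 'a" where ts: "map (\<lambda>(x, u, y). (x, y)) ts = qs"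
    and T: "norm T \<le> 1 + e" "\<forall>x\<in>fst ` set qs. norm (blinfun_apply T x - x) < e"
    and u: "\<forall>(x, u, y)\<in>set ts. norm u \<le> norm x \<and> norm (blinfun_apply T u + x) < e"
    and err: "(\<Sum>\<phi>\<in>\<Phi>. (\<Sum>(x, u, y)\<leftarrow>ts. B \<phi> (u - x) y)\<^sup>2)
      \<le> (\<Sum>(x, y)\<leftarrow>qs. \<alpha> + real (card \<Phi>) * (2 * K * (norm x * norm y))\<^sup>2)"
    using WODP_reflection[OF assms(2,1) \<open>finite \<Phi>\<close>, of B K \<alpha> e "fst ` set qs" qs] K(1) \<alpha> e by blast
  have proj: "(\<Sum>(x, y)\<leftarrow>qs. h x y) = (\<Sum>(x, u, y)\<leftarrow>ts. h x y)" for h :: "'a \<Rightarrow> 'b \<Rightarrow> 'c::monoid_add"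
    unfolding ts[symmetric] by (induction ts) auto
  define v where "v = (\<Sum>(x, u, y)\<leftarrow>ts. elem_tensor u y)"
  have "v = (\<Sum>(x, y)\<leftarrow>map snd ts. elem_tensor x y)"
    unfolding v_def by (induction ts) auto
  then have "proj_norm v \<le> (\<Sum>(x, y)\<leftarrow>map snd ts. norm x * norm y)" by (rule proj_norm_le)
  also have "\<dots> \<le> (\<Sum>(x, u, y)\<leftarrow>ts. norm x * norm y)"
    using u by (induction ts) (auto intro!: add_mono mult_right_mono)
  also have "\<dots> \<le> 1" using ps qs by (simp flip: proj)
  finally have v1: "proj_norm v \<le> 1" .
  have "\<bar>\<phi> (of_tensor v) - \<phi> z\<bar> < \<delta>" if \<phi>: "\<phi> \<in> \<Phi>" for \<phi>
  proof -
    have "\<phi> (of_tensor v) - \<phi> (of_tensor t) = (\<Sum>(x, u, y)\<leftarrow>ts. B \<phi> (u - x) y)"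
      unfolding v_def t_def proj B_def
      by (induction ts) (auto simp: linear_0[OF linear_of_tensor] linear_add[OF linear_of_tensor]
          linear_diff[OF linear_of_tensor] elem_tensor_diff_left blinfun.add_right blinfun.diff_right)
    then have "(\<phi> (of_tensor v) - \<phi> (of_tensor t))\<^sup>2 \<le> (\<Sum>\<phi>\<in>\<Phi>. (\<Sum>(x, u, y)\<leftarrow>ts. B \<phi> (u - x) y)\<^sup>2)"
      using \<phi> \<open>finite \<Phi>\<close> by (auto intro!: member_le_sum)
    also note err
    also have "(\<Sum>(x, y)\<leftarrow>qs. \<alpha> + real (card \<Phi>) * (2 * K * (norm x * norm y))\<^sup>2)
        = real (length qs) * \<alpha> + C * (\<Sum>(x, y)\<leftarrow>qs. (norm x * norm y)\<^sup>2)"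
      by (induction qs) (auto simp: C_def algebra_simps power_mult_distrib)
    also have "\<dots> \<le> \<delta>\<^sup>2 / 8 + \<delta>\<^sup>2 / 8"
    proof (rule add_mono)
      have "real (length qs) * \<alpha> \<le> (real (length qs) + 1) * \<alpha>" using \<alpha> by (intro mult_right_mono) auto
      also have "\<dots> = \<delta>\<^sup>2 / 8" by (simp add: \<alpha>_def field_simps)
      finally show "real (length qs) * \<alpha> \<le> \<delta>\<^sup>2 / 8" .
      have "C * (\<Sum>(x, y)\<leftarrow>qs. (norm x * norm y)\<^sup>2) \<le> (C + 1) * (\<delta>\<^sup>2 / 8 / (C + 1))"
        using qs(3) C by (intro mult_mono sum_list_nonneg) auto
      also have "\<dots> = \<delta>\<^sup>2 / 8" using C by (simp add: field_simps)
      finally show "C * (\<Sum>(x, y)\<leftarrow>qs. (norm x * norm y)\<^sup>2) \<le> \<delta>\<^sup>2 / 8" .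
    qed
    also have "\<dots> = (\<delta> / 2)\<^sup>2" by (simp add: power2_eq_square)
    finally have "\<bar>\<phi> (of_tensor v) - \<phi> (of_tensor t)\<bar> \<le> \<delta> / 2"
      using \<delta> by (simp add: abs_le_square_iff[symmetric])
    moreover have "\<bar>\<phi> (of_tensor t) - \<phi> z\<bar> < \<delta> / 2"
    proof -
      have "norm (of_tensor t - z) < \<eta>" using t by (simp add: norm_minus_commute)
      then have "norm \<phi> * norm (of_tensor t - z) \<le> K * \<eta>"
        using K(1) K(2)[OF \<phi>] by (intro mult_mono) auto
      with norm_blinfun[of \<phi> "of_tensor t - z"] K\<eta> \<delta> show ?thesis
        by (simp add: blinfun.diff_right)
    qed
    ultimately show ?thesis by linarith
  qed
  then have "of_tensor v \<in> U" using nbhd by blast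
  with v1 U(2) have vW: "of_tensor v \<in> W" by (simp add: norm_of_tensor)
  have far: "2 * proj_norm t \<le> norm T * proj_norm (v - t) + 2 * e * Y"
    unfolding v_def t_def Y_def proj
  proof (rule reflection_far)
    fix x u y assume "(x, u, y) \<in> set ts"
    then have "x \<in> fst ` set qs" unfolding ts[symmetric] by force
    then show "norm (blinfun_apply T u + x) \<le> e \<and> norm (blinfun_apply T x - x) \<le> e"
      using u T(2) \<open>(x, u, y) \<in> set ts\<close> by force
  qed
  have "1 - \<eta> < proj_norm t"
    using t z norm_triangle_ineq2[of z "of_tensor t"] by (simp add: norm_of_tensor)
  moreover have t1: "proj_norm t \<le> 1" using proj_norm_le[OF t_def] ps qs by simp
  moreover have "norm T * proj_norm (v - t) \<le> proj_norm (v - t) + 2 * e"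
  proof -
    have "proj_norm (v - t) \<le> 2"
      using proj_norm_triangle[of v "- t"] v1 t1 by simp
    then have "e * proj_norm (v - t) \<le> e * 2" using e by (intro mult_left_mono) auto
    moreover have "norm T * proj_norm (v - t) \<le> (1 + e) * proj_norm (v - t)"
      using T by (intro mult_right_mono proj_norm_nonneg)
    ultimately show ?thesis by (simp add: algebra_simps)
  qed
  moreover have "2 * e + 2 * e * Y = \<epsilon> / 4" using e(2) by (simp add: algebra_simps)
  moreover have "proj_norm (v - t) - \<eta> < norm (of_tensor v - z)"
  proof -
    have "proj_norm (v - t) = norm ((of_tensor v - z) + (z - of_tensor t))"
      by (simp add: norm_of_tensor[symmetric] linear_diff[OF linear_of_tensor])
    with norm_triangle_ineq[of "of_tensor v - z" "z - of_tensor t"] t show ?thesis by linarith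
  qed
  ultimately have "2 - \<epsilon> < norm (of_tensor v - z)" using far \<eta> \<epsilon> by linarith
  with vW show "\<exists>w\<in>W. norm (w - z) > 2 - \<epsilon>" by blast
qed

end
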